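(* A graph $G$ is a threshold graph if and only if $\Omega_0(G)=0$.
   Context: Graphs are finite and simple. A graph $G$ with vertex set $V$ is a threshold graph if there exists a linear order $\prec$ on $V$ such that $v\prec w$ implies $N(v)\setminus\{v,w\}\subseteq N(w)\setminus\{v,w\}$, where $N(v)$ is the set of neighbours of $v$. Let $n=|V|$. For $v\in V$ and $A\subseteq V$ let $e(v,A)=|N(v)\cap A|$. Write $x_+=\max\{x,0\}$. For a linear order $\prec$ on $V$ and $A\subseteq V$ set $$\Omega_0(G,\prec,A)=\frac1{n^3}\sum_{v\prec w}\bigl(e(v,A\setminus\{v,w\})-e(w,A\setminus\{v,w\})\bigr)_+,$$ the sum being over all pairs $(v,w)\in V^2$ with $v\prec w$. Set $\Omega_0(G,\prec)=\max_{A\subseteq V}\Omega_0(G,\prec,A)$ and $\Omega_0(G)=\min_{\prec}\Omega_0(G,\prec)$, the minimum being over all linear orders on $V$. *)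

theory Defs
  imports Complex_Main "Graph_Theory.Digraph"
begin

text \<open>
  A finite simple graph is a \<^locale>\<open>graph\<close>, i.e. a finite symmetric digraph without
  loops and parallel arcs; \<^const>\<open>arcs_ends\<close> is its adjacency relation.
  A linear order on the vertices is given by the reflexive relation \<open>r\<close> with
  \<^term>\<open>linear_order_on (verts G) r\<close>, so that \<open>v \<prec> w\<close> is \<^term>\<open>(v, w) \<in> r - Id\<close>.
\<close>

definition nbhd :: "('a, 'b) pre_digraph \<Rightarrow> 'a \<Rightarrow> 'a set" where
  "nbhd G v = {w \<in> verts G. v \<rightarrow>\<^bsub>G\<^esub> w}"

definition threshold_graph :: "('a, 'b) pre_digraph \<Rightarrow> bool" where
  "threshold_graph G \<longleftrightarrow> graph G \<and>
     (\<exists>r. linear_order_on (verts G) r \<and>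
          (\<forall>v w. (v, w) \<in> r - Id \<longrightarrow> nbhd G v - {v, w} \<subseteq> nbhd G w - {v, w}))"

definition edges_into :: "('a, 'b) pre_digraph \<Rightarrow> 'a \<Rightarrow> 'a set \<Rightarrow> nat" where
  "edges_into G v A = card (nbhd G v \<inter> A)"

definition Omega0_set :: "('a, 'b) pre_digraph \<Rightarrow> 'a rel \<Rightarrow> 'a set \<Rightarrow> real" where
  "Omega0_set G r A = 1 / real (card (verts G)) ^ 3 *
     (\<Sum>(v, w)\<in>r - Id.
        max (real (edges_into G v (A - {v, w})) - real (edges_into G w (A - {v, w}))) 0)"

definition Omega0_order :: "('a, 'b) pre_digraph \<Rightarrow> 'a rel \<Rightarrow> real" where
  "Omega0_order G r = Max {Omega0_set G r A | A. A \<subseteq> verts G}"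

definition Omega0 :: "('a, 'b) pre_digraph \<Rightarrow> real" where
  "Omega0 G = Min {Omega0_order G r | r. linear_order_on (verts G) r}"

text \<open>The maximum and the minimum are taken over finite nonempty sets.\<close>

lemma Omega0_order_range:
  assumes "finite (verts G)"
  shows "finite {Omega0_set G r A | A. A \<subseteq> verts G}"
    and "{Omega0_set G r A | A. A \<subseteq> verts G} \<noteq> {}"
proof -
  have "{Omega0_set G r A | A. A \<subseteq> verts G} = Omega0_set G r ` Pow (verts G)"
    by auto
  then show "finite {Omega0_set G r A | A. A \<subseteq> verts G}"
    using assms by simp
qed auto

lemma Omega0_range:
  assumes "finite (verts G)"
  shows "finite {Omega0_order G r | r. linear_order_on (verts G) r}"
    and "{Omega0_order G r | r. linear_order_on (verts G) r} \<noteq> {}"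
proof -
  have "{Omega0_order G r | r. linear_order_on (verts G) r}
      \<subseteq> Omega0_order G ` Pow (verts G \<times> verts G)"
    by (auto simp: order_on_defs)
  then show "finite {Omega0_order G r | r. linear_order_on (verts G) r}"
    using assms by (meson finite_Pow_iff finite_SigmaI finite_imageI finite_subset)
  obtain r where "well_order_on (verts G) r"
    using well_order_on by blast
  then show "{Omega0_order G r | r. linear_order_on (verts G) r} \<noteq> {}"
    by (auto simp: well_order_on_def)
qed

end

theory Submission
  imports Defs
begin

text \<open>
  All terms of the sums are nonnegative, so \<open>\<Omega>\<^sub>0(G) = 0\<close> holds iff some order makes every
  term vanish for every \<open>A\<close>. Inclusion of neighbourhoods clearly makes them vanish; conversely, a
  vertex \<open>u\<close> violating the inclusion for \<open>v \<prec> w\<close> is detected by the choice \<open>A = {u}\<close>.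
\<close>

lemma Omega0_set_nonneg: "0 \<le> Omega0_set G r A"
  unfolding Omega0_set_def by (intro mult_nonneg_nonneg sum_nonneg) auto

lemma Omega0_order_nonneg:
  assumes "finite (verts G)"
  shows "0 \<le> Omega0_order G r"
proof -
  have "Omega0_order G r \<in> {Omega0_set G r A | A. A \<subseteq> verts G}"
    unfolding Omega0_order_def using Omega0_order_range[OF assms] by (rule Max_in)
  then show ?thesis
    using Omega0_set_nonneg by auto
qed

text \<open>A finite sum of nonnegative terms vanishes only if every term does, and a positive part
  vanishes exactly when the difference inside it is at most 0.\<close>

lemma Omega0_set_eq_0_iff:
  assumes "finite (verts G)" and "linear_order_on (verts G) r"
  shows "Omega0_set G r A = 0 \<longleftrightarrow>
    (\<forall>v w. (v, w) \<in> r - Id \<longrightarrow>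
      edges_into G v (A - {v, w}) \<le> edges_into G w (A - {v, w}))"
proof -
  have r: "r \<subseteq> verts G \<times> verts G"
    using assms(2) by (auto simp: order_on_defs)
  then have fin: "finite (r - Id)"
    using assms(1) by (meson finite_Diff finite_SigmaI finite_subset)
  show ?thesis
  \<comment> \<open>Cancelling the prefactor requires \<open>card (verts G)\<close> to be nonzero.
    For the empty graph \<open>r\<close> is empty, so both sides hold trivially.\<close>
  proof (cases "verts G = {}")
    case True
    then show ?thesis
      using r by (auto simp: Omega0_set_def)
  next
    case False
    define f where "f v w =
      max (real (edges_into G v (A - {v, w})) - real (edges_into G w (A - {v, w}))) 0" for v w
    have "Omega0_set G r A = 0 \<longleftrightarrow> (\<Sum>p\<in>r - Id. f (fst p) (snd p)) = 0"
      using False assms(1) by (simp add: Omega0_set_def f_def case_prod_unfold)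
    also have "\<dots> \<longleftrightarrow> (\<forall>p\<in>r - Id. f (fst p) (snd p) = 0)"
      by (rule sum_nonneg_eq_0_iff[OF fin]) (simp add: f_def)
    also have "\<dots> \<longleftrightarrow> (\<forall>v w. (v, w) \<in> r - Id \<longrightarrow> f v w = 0)"
      by (metis fst_conv prod.collapse snd_conv)
    also have "\<dots> \<longleftrightarrow> (\<forall>v w. (v, w) \<in> r - Id \<longrightarrow>
        edges_into G v (A - {v, w}) \<le> edges_into G w (A - {v, w}))"
      by (auto simp: f_def max_def)
    finally show ?thesis .
  qed
qed

text \<open>This is the theorem for one fixed order. Letting \<open>A\<close> range over all vertex
  sets is what turns comparisons of cardinalities into inclusions.\<close>

lemma Omega0_order_eq_0_iff:
  assumes "finite (verts G)" and "linear_order_on (verts G) r"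
  shows "Omega0_order G r = 0 \<longleftrightarrow>
    (\<forall>v w. (v, w) \<in> r - Id \<longrightarrow> nbhd G v - {v, w} \<subseteq> nbhd G w - {v, w})"
    (is "_ \<longleftrightarrow> ?nested")
proof -
  \<comment> \<open>By nonnegativity, equations with 0 can be traded for upper bounds, the form in
    which a maximum splits into its members.\<close>
  have le_0_iff: "Omega0_set G r A \<le> 0 \<longleftrightarrow> Omega0_set G r A = 0" for A
    using Omega0_set_nonneg[of G r A] by linarith
  have "Omega0_order G r = 0 \<longleftrightarrow> Omega0_order G r \<le> 0"
    using Omega0_order_nonneg[OF assms(1), of r] by linarith
  also have "\<dots> \<longleftrightarrow> (\<forall>A\<subseteq>verts G. Omega0_set G r A \<le> 0)"
    unfolding Omega0_order_def using Omega0_order_range[OF assms(1)] by (subst Max_le_iff) auto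
  also have "\<dots> \<longleftrightarrow> (\<forall>A\<subseteq>verts G. Omega0_set G r A = 0)"
    by (simp only: le_0_iff)
  also have "\<dots> \<longleftrightarrow> ?nested"
  proof
    assume vanish: "\<forall>A\<subseteq>verts G. Omega0_set G r A = 0"
    show ?nested
    proof (intro allI impI subsetI)
      fix v w u
      assume vw: "(v, w) \<in> r - Id" and u: "u \<in> nbhd G v - {v, w}"
      then have "u \<in> verts G"
        by (simp add: nbhd_def)
      then have "Omega0_set G r {u} = 0"
        using vanish by simp
      then have "edges_into G v ({u} - {v, w}) \<le> edges_into G w ({u} - {v, w})"
        using vw Omega0_set_eq_0_iff[OF assms] by blast
      \<comment> \<open>Since \<open>u\<close> differs from \<open>v\<close> and \<open>w\<close>,
        it survives the removal of the pair, so the count at \<open>v\<close> is exactly 1 and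
        forces a positive count at \<open>w\<close>.\<close>
      moreover have eq: "{u} - {v, w} = {u}" and "nbhd G v \<inter> {u} = {u}"
        using u by auto
      ultimately have "1 \<le> card (nbhd G w \<inter> {u})"
        unfolding edges_into_def eq by simp
      then have "nbhd G w \<inter> {u} \<noteq> {}"
        by (metis card.empty not_one_le_zero)
      then show "u \<in> nbhd G w - {v, w}"
        using u by auto
    qed
  next
    assume nested: ?nested
    have "edges_into G v (A - {v, w}) \<le> edges_into G w (A - {v, w})"
      if "(v, w) \<in> r - Id" for v w A
      unfolding edges_into_def
    proof (rule card_mono)
      show "finite (nbhd G w \<inter> (A - {v, w}))"
        using assms(1) by (simp add: nbhd_def)
      show "nbhd G v \<inter> (A - {v, w}) \<subseteq> nbhd G w \<inter> (A - {v, w})"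
        using nested that by blast
    qed
    then show "\<forall>A\<subseteq>verts G. Omega0_set G r A = 0"
      unfolding Omega0_set_eq_0_iff[OF assms] by blast
  qed
  finally show ?thesis .
qed

text \<open>The minimum is attained, and 0 is a lower bound for every order, so it equals 0 exactly
  when some order reaches 0.\<close>

lemma Omega0_eq_0_iff:
  assumes "finite (verts G)"
  shows "Omega0 G = 0 \<longleftrightarrow> (\<exists>r. linear_order_on (verts G) r \<and> Omega0_order G r = 0)"
  unfolding Omega0_def using Omega0_order_nonneg[OF assms]
  by (subst Min_eq_iff[OF Omega0_range[OF assms]]) auto

theorem proposition1p4:
  fixes G :: "('a, 'b) pre_digraph"
  assumes "graph G"
  shows "threshold_graph G \<longleftrightarrow> Omega0 G = 0"
proof -
  interpret graph G by fact
  show ?thesis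
    unfolding threshold_graph_def Omega0_eq_0_iff[OF finite_verts]
    using assms Omega0_order_eq_0_iff[OF finite_verts] by blast
qed

end
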